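(* There exists a sequence $(x_n)_{n\ge 0}$ in $\mathbb{R}/\mathbb{Z}$ and an absolute constant $C>0$ such that for every integer $k\ge 1$, \[ A_k:=\sup_{N\ge 1}\Bigl|\sum_{n=0}^{N-1} e^{2\pi i k x_n}\Bigr|\ \le\ C\sqrt{k\log(2k)} . \] *)

theory Defs
  imports "HOL-Analysis.Analysis"
begin

definition cong_mod_int :: "real \<Rightarrow> real \<Rightarrow> bool" where
  "cong_mod_int x y \<longleftrightarrow> x - y \<in> \<int>"

lemma equivp_cong_mod_int: "equivp cong_mod_int"
proof (rule equivpI)
  show "reflp cong_mod_int"
    by (rule reflpI) (simp add: cong_mod_int_def)
  show "symp cong_mod_int"
    by (rule sympI) (metis Ints_minus cong_mod_int_def minus_diff_eq)
  show "transp cong_mod_int"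
  proof (rule transpI)
    fix x y z assume "cong_mod_int x y" "cong_mod_int y z"
    then have "(x - y) + (y - z) \<in> \<int>"
      unfolding cong_mod_int_def by (rule Ints_add)
    then show "cong_mod_int x z" by (simp add: cong_mod_int_def)
  qed
qed

quotient_type real_mod_int = real / cong_mod_int
  by (rule equivp_cong_mod_int)

lift_definition circle_char :: "int \<Rightarrow> real_mod_int \<Rightarrow> complex"
  is "\<lambda>k x. exp (2 * of_real pi * \<i> * of_int k * of_real x)"
proof -
  fix k :: int and x y :: real
  assume "cong_mod_int x y"
  then obtain m :: int where "x - y = of_int m"
    unfolding cong_mod_int_def by (auto elim: Ints_cases)
  then have x: "x = y + of_int m" by simp
  have "exp (2 * of_real pi * \<i> * of_int k * of_real x)
      = exp (2 * of_real pi * \<i> * of_int k * of_real y)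
        * exp (2 * of_real pi * \<i> * of_int (k * m))"
    unfolding x exp_add [symmetric] by (simp add: algebra_simps)
  also have "exp (2 * of_real pi * \<i> * of_int (k * m)) = 1"
    using exp_integer_2pi [of "of_int (k * m)"] by (simp add: algebra_simps)
  finally show "exp (2 * of_real pi * \<i> * of_int k * of_real x)
      = exp (2 * of_real pi * \<i> * of_int k * of_real y)" by simp
qed

(* The supremum is taken in the extended reals: it is infinite when the partial sums
   are unbounded, whereas the real-valued Sup would be unspecified there. *)
definition exp_sum_sup :: "(nat \<Rightarrow> real_mod_int) \<Rightarrow> int \<Rightarrow> ereal" where
  "exp_sum_sup x k = (SUP N\<in>{1::nat..}. ereal (cmod (\<Sum>n<N. circle_char k (x n))))"

end

theory Submission
  imports Defs
begin

text \<open>Build nested dyadic intervals as in the van der Corput sequence, so that at level \<open>i\<close>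
  the first \<open>2 ^ i\<close> indices meet each interval of length \<open>1 / 2 ^ i\<close> once, but let signs
  \<open>\<epsilon> r\<close>, \<open>r < 2 ^ i\<close>, decide which half of the \<open>r\<close>-th interval goes to index \<open>r\<close> and
  which to \<open>2 ^ i + r\<close>. Let \<open>M i n\<close> be the mean of \<open>exp (2 * pi * \<i> * k * x)\<close> over the
  level-\<open>i\<close> interval of index \<open>n\<close>. Its sum over \<open>n < 2 ^ i\<close> is the integral over a
  full period, hence zero, and passing from level \<open>i\<close> to \<open>i + 1\<close> changes partial sums by
  prefix sums of \<open>\<epsilon> r * exp (2 * pi * \<i> * k * c r)\<close>, \<open>c r\<close> the interval centers, times a
  factor of size at most \<open>min 1 (k / 2 ^ i)\<close> up to a constant. Suitable signs keep
  all these prefix sums below \<open>sqrt (2 ^ i * ln (2 * k))\<close> up to a constant, simultaneously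
  for all \<open>k\<close>. The resulting series in \<open>i\<close> grows and decays geometrically on either side
  of \<open>2 ^ i = k\<close>, which gives \<open>sqrt (k * ln (2 * k))\<close>.\<close>

section \<open>Signs that keep all prefix sums small\<close>

lemma cosh_le_exp_square: "cosh y \<le> exp (y\<^sup>2)" for y :: real
proof -
  have main: "cosh z \<le> exp (z\<^sup>2)" if "0 \<le> z" for z :: real
  proof (cases "z \<le> 1")
    case True
    have "exp z \<le> 1 + z + z\<^sup>2"
      using exp_bound[of z] that True by simp
    moreover have "exp (- z) \<le> 1 - z + z\<^sup>2"
    proof -
      \<comment> \<open>The product equals \<open>1 + z ^ 3\<close>.\<close>
      have "1 \<le> (1 - z + z\<^sup>2) * (1 + z)"
        using that by (simp add: algebra_simps power2_eq_square)
      also have "\<dots> \<le> (1 - z + z\<^sup>2) * exp z"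
        using True by (intro mult_left_mono exp_ge_add_one_self) auto
      finally show ?thesis
        by (simp add: exp_minus field_simps)
    qed
    ultimately have "cosh z \<le> 1 + z\<^sup>2"
      by (simp add: cosh_def)
    also have "\<dots> \<le> exp (z\<^sup>2)"
      by (rule exp_ge_add_one_self)
    finally show ?thesis .
  next
    case False
    then have "z \<le> z\<^sup>2"
      by (simp add: power2_eq_square)
    moreover have "cosh z \<le> exp z"
      using that by (simp add: cosh_def)
    ultimately show ?thesis
      by (meson exp_le_cancel_iff order_trans)
  qed
  show ?thesis
    using main[of "\<bar>y\<bar>"] by (cases "0 \<le> y") auto
qed

text \<open>Averaging over the sign of the last term multiplies each
  \<open>cosh\<close> by \<open>cosh (b s n) \<le> exp ((b s n)\<^sup>2)\<close>, so one of the two signs does not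
  increase the potential. Choosing signs greedily controls all prefix sums at once.\<close>

lemma exists_signs_potential:
  fixes b :: "'s \<Rightarrow> nat \<Rightarrow> real" and w :: "'s \<Rightarrow> real"
  assumes "\<And>s. s \<in> S \<Longrightarrow> 0 \<le> w s"
  shows "\<exists>\<epsilon> :: nat \<Rightarrow> real. (\<forall>r. \<epsilon> r \<in> {1, -1}) \<and>
    (\<forall>t\<le>n. (\<Sum>s\<in>S. w s * cosh (\<Sum>r<t. \<epsilon> r * b s r) * exp (- (\<Sum>r<t. (b s r)\<^sup>2))) \<le> sum w S)"
    (is "\<exists>\<epsilon>. _ \<and> (\<forall>t\<le>n. ?\<Phi> \<epsilon> t \<le> _)")
proof (induction n)
  case 0
  show ?case by (rule exI[of _ "\<lambda>_. 1"]) simp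
next
  case (Suc n)
  then obtain \<epsilon> where \<epsilon>: "\<And>r. \<epsilon> r \<in> {1, -1}" and le: "\<And>t. t \<le> n \<Longrightarrow> ?\<Phi> \<epsilon> t \<le> sum w S"
    by blast
  define X where "X s = (\<Sum>r<n. \<epsilon> r * b s r)" for s
  define V where "V s = (\<Sum>r<n. (b s r)\<^sup>2)" for s
  have old: "?\<Phi> (\<epsilon>(n := e)) t = ?\<Phi> \<epsilon> t" if "t \<le> n" for e t
    using that by (intro sum.cong refl arg_cong2[where f = "(*)"] arg_cong[where f = cosh]) auto
  have new: "?\<Phi> (\<epsilon>(n := e)) (Suc n)
      = (\<Sum>s\<in>S. w s * cosh (X s + e * b s n) * exp (- (V s + (b s n)\<^sup>2)))" for e
    by (simp add: X_def V_def)
  \<comment> \<open>Summed over both signs, the \<open>sinh\<close> terms of the addition formula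
    cancel.\<close>
  have "?\<Phi> (\<epsilon>(n := 1)) (Suc n) + ?\<Phi> (\<epsilon>(n := -1)) (Suc n)
      = (\<Sum>s\<in>S. 2 * (w s * cosh (X s) * exp (- V s)) * (cosh (b s n) * exp (- (b s n)\<^sup>2)))"
    unfolding new sum.distrib[symmetric]
    by (intro sum.cong refl)
      (simp add: cosh_add cosh_diff exp_add exp_diff exp_minus field_simps)
  also have "\<dots> \<le> (\<Sum>s\<in>S. 2 * (w s * cosh (X s) * exp (- V s)) * 1)"
  proof (intro sum_mono mult_left_mono)
    fix s assume "s \<in> S"
    show "cosh (b s n) * exp (- (b s n)\<^sup>2) \<le> 1"
      using cosh_le_exp_square[of "b s n"] by (simp add: exp_minus field_simps)
    show "0 \<le> 2 * (w s * cosh (X s) * exp (- V s))"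
      using assms[OF \<open>s \<in> S\<close>] by (simp add: cosh_real_nonneg)
  qed
  also have "\<dots> = 2 * ?\<Phi> \<epsilon> n"
    by (simp add: X_def V_def sum_distrib_left)
  also have "\<dots> \<le> 2 * sum w S"
    using le[of n] by simp
  finally have "?\<Phi> (\<epsilon>(n := 1)) (Suc n) \<le> sum w S \<or> ?\<Phi> (\<epsilon>(n := -1)) (Suc n) \<le> sum w S"
    by linarith
  then obtain e :: real where e: "e \<in> {1, -1}" "?\<Phi> (\<epsilon>(n := e)) (Suc n) \<le> sum w S"
    by blast
  have "?\<Phi> (\<epsilon>(n := e)) t \<le> sum w S" if "t \<le> Suc n" for t
    using that e(2) old[of t e] le[of t] by (cases "t = Suc n") auto
  then show ?case
    using \<epsilon> e(1) by (intro exI[of _ "\<epsilon>(n := e)"]) auto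
qed

lemma sum_inverse_squares_le: "(\<Sum>k=1..K. 1 / (real k)\<^sup>2) \<le> 2"
proof -
  have "(\<Sum>k=1..Suc K. 1 / (real k)\<^sup>2) \<le> 2 - 1 / real (Suc K)" for K
  proof (induction K)
    case (Suc K)
    have "1 / (real (Suc (Suc K)))\<^sup>2 \<le> 1 / real (Suc K) - 1 / real (Suc (Suc K))"
      by (simp add: divide_simps power2_eq_square)
    with Suc show ?case by simp
  qed simp
  from this[of "K - 1"] show ?thesis
    by (cases K) (auto intro: order_trans)
qed

text \<open>The weights \<open>w\<close> sum to at most 1, so each single term of the potential
  stays at most 1. With \<open>l k\<close> scaled so that the squares sum to at most
  \<open>ln (2 * k)\<close>, this bounds \<open>cosh (l k * X)\<close> by a power of
  \<open>2 * k\<close>. Real and imaginary parts are handled as separate real sequences.\<close>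

lemma exists_signs_finite_family:
  fixes a :: "nat \<Rightarrow> nat \<Rightarrow> complex" and n :: nat
  assumes "n > 0" and a: "\<And>k r. cmod (a k r) \<le> 1"
  shows "\<exists>\<epsilon> :: nat \<Rightarrow> real. (\<forall>r. \<epsilon> r \<in> {1, -1}) \<and>
    (\<forall>k\<in>{1..K}. \<forall>t\<le>n. cmod (\<Sum>r<t. \<epsilon> r * a k r) \<le> 8 * sqrt (n * ln (2 * real k)))"
proof -
  define S where "S = {1..K} \<times> {Re, Im}"
  define w where "w = (\<lambda>(k, p :: complex \<Rightarrow> real). 1 / (2 * real k)\<^sup>2)"
  define l where "l k = sqrt (ln (2 * real k) / n)" for k :: nat
  define b where "b = (\<lambda>(k, p :: complex \<Rightarrow> real) r. l k * p (a k r))"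
  have "Re \<i> \<noteq> Im \<i>" by simp
  then have "Re \<noteq> Im" by metis
  have "sum w S = (\<Sum>k=1..K. \<Sum>p\<in>{Re, Im}. w (k, p))"
    unfolding S_def by (subst sum.cartesian_product) simp
  also have "\<dots> = (\<Sum>k=1..K. 1 / (real k)\<^sup>2) / 2"
    using \<open>Re \<noteq> Im\<close> unfolding sum_divide_distrib
    by (intro sum.cong) (auto simp: w_def power_mult_distrib)
  finally have w: "sum w S \<le> 1"
    using sum_inverse_squares_le[of K] by simp
  have w0: "0 \<le> w s" for s
    by (auto simp: w_def split: prod.split)
  obtain \<epsilon> :: "nat \<Rightarrow> real" where \<epsilon>: "\<And>r. \<epsilon> r \<in> {1, -1}"
    and pot: "\<And>t. t \<le> n \<Longrightarrow>
      (\<Sum>s\<in>S. w s * cosh (\<Sum>r<t. \<epsilon> r * b s r) * exp (- (\<Sum>r<t. (b s r)\<^sup>2))) \<le> sum w S"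
    using exists_signs_potential[of S w n b] w0 by blast
  have part: "\<bar>\<Sum>r<t. \<epsilon> r * p (a k r)\<bar> \<le> 4 * sqrt (n * ln (2 * real k))"
    if k: "k \<in> {1..K}" and t: "t \<le> n" and p: "p \<in> {Re, Im}" for k t p
  proof -
    define X where "X = (\<Sum>r<t. \<epsilon> r * p (a k r))"
    define L where "L = ln (2 * real k)"
    have "ln 2 \<le> L" using k by (simp add: L_def)
    moreover have "0 < ln (2 :: real)" by simp
    ultimately have "0 < L" by linarith
    have l: "0 < l k" "(l k)\<^sup>2 = L / n"
      using \<open>0 < L\<close> \<open>n > 0\<close> by (simp_all add: l_def L_def)
    have mem: "(k, p) \<in> S" using k p by (simp add: S_def)
    have "finite S" by (simp add: S_def)
    have V: "(\<Sum>r<t. (b (k, p) r)\<^sup>2) \<le> L"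
    proof -
      have "(b (k, p) r)\<^sup>2 \<le> L / n" for r
      proof -
        have "\<bar>p (a k r)\<bar> \<le> 1"
          using p a[of k r] abs_Re_le_cmod[of "a k r"] abs_Im_le_cmod[of "a k r"] by auto
        then have "(p (a k r))\<^sup>2 \<le> 1"
          by (simp add: abs_square_le_1)
        then show ?thesis
          using l \<open>0 < L\<close> by (simp add: b_def power_mult_distrib divide_right_mono mult_left_le)
      qed
      then have "(\<Sum>r<t. (b (k, p) r)\<^sup>2) \<le> (\<Sum>r<t. L / n)"
        by (intro sum_mono)
      also have "\<dots> \<le> L"
        using t \<open>0 < L\<close> \<open>n > 0\<close> by (simp add: field_simps)
      finally show ?thesis .
    qed
    have bX: "(\<Sum>r<t. \<epsilon> r * b (k, p) r) = l k * X"
      by (simp add: b_def X_def sum_distrib_left mult_ac)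
    have "w (k, p) * cosh (l k * X) * exp (- (\<Sum>r<t. (b (k, p) r)\<^sup>2))
        \<le> (\<Sum>s\<in>S. w s * cosh (\<Sum>r<t. \<epsilon> r * b s r) * exp (- (\<Sum>r<t. (b s r)\<^sup>2)))"
      unfolding bX[symmetric]
      using mem \<open>finite S\<close> w0
      by (intro member_le_sum[where f = "\<lambda>s. w s * cosh (\<Sum>r<t. \<epsilon> r * b s r) * exp (- (\<Sum>r<t. (b s r)\<^sup>2))"])
         (auto simp: cosh_real_nonneg)
    also have "\<dots> \<le> 1"
      using pot[OF t] w by linarith
    finally have "w (k, p) * cosh (l k * X) \<le> exp (\<Sum>r<t. (b (k, p) r)\<^sup>2)"
      by (simp add: exp_minus field_simps)
    also have "\<dots> \<le> exp L" using V by simp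
    finally have "cosh (l k * X) \<le> exp L * (2 * real k)\<^sup>2"
      using k by (simp add: w_def field_simps)
    also have "2 * real k = exp L" using k by (simp add: L_def)
    also have "exp L * (exp L)\<^sup>2 = exp (3 * L)"
      by (simp add: exp_add[symmetric] power2_eq_square)
    finally have "cosh (l k * X) \<le> exp (3 * L)" .
    moreover have "exp \<bar>l k * X\<bar> \<le> 2 * cosh (l k * X)"
      by (cases "0 \<le> l k * X") (auto simp: cosh_def)
    \<comment> \<open>Since \<open>exp L = 2 * k\<close> is at least 2, it absorbs the factor 2. The
      final \<open>4 * L\<close> collects one \<open>L\<close> from the squares, two from the weight
      and one from here.\<close>
    moreover have "2 * exp (3 * L) \<le> exp L * exp (3 * L)"
      using k by (intro mult_right_mono) (simp_all add: L_def)
    ultimately have "exp \<bar>l k * X\<bar> \<le> exp L * exp (3 * L)"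
      by linarith
    then have "l k * \<bar>X\<bar> \<le> 4 * L"
      using l(1) by (simp add: exp_add[symmetric] abs_mult)
    then have "\<bar>X\<bar> \<le> 4 * (L / l k)"
      using l(1) by (simp add: field_simps)
    also have "L / l k = L / sqrt L * sqrt n"
      unfolding l_def L_def[symmetric] by (simp add: real_sqrt_divide)
    also have "\<dots> = sqrt (n * L)"
      using \<open>0 < L\<close> by (simp add: real_div_sqrt real_sqrt_mult)
    finally show ?thesis
      by (simp add: X_def L_def)
  qed
  have "cmod (\<Sum>r<t. \<epsilon> r * a k r) \<le> 8 * sqrt (n * ln (2 * real k))"
    if k: "k \<in> {1..K}" and t: "t \<le> n" for k t
    using part[OF k t, of Re] part[OF k t, of Im] cmod_le[of "\<Sum>r<t. \<epsilon> r * a k r"]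
    by simp
  then show ?thesis using \<epsilon> by blast
qed

text \<open>Frequencies beyond \<open>2 ^ n\<close> need no cancellation, which reduces the infinite family
  of frequencies to a finite one.\<close>

lemma exists_signs:
  fixes a :: "nat \<Rightarrow> nat \<Rightarrow> complex" and n :: nat
  assumes "n > 0" and a: "\<And>k r. cmod (a k r) \<le> 1"
  shows "\<exists>\<epsilon> :: nat \<Rightarrow> real. (\<forall>r. \<epsilon> r \<in> {1, -1}) \<and>
    (\<forall>k\<ge>1. \<forall>t\<le>n. cmod (\<Sum>r<t. \<epsilon> r * a k r) \<le> 8 * sqrt (n * ln (2 * real k)))"
proof -
  obtain \<epsilon> :: "nat \<Rightarrow> real" where \<epsilon>: "\<And>r. \<epsilon> r \<in> {1, -1}"
    and small: "\<And>k t. k \<in> {1..2 ^ n} \<Longrightarrow> t \<le> n \<Longrightarrow>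
      cmod (\<Sum>r<t. \<epsilon> r * a k r) \<le> 8 * sqrt (n * ln (2 * real k))"
    using exists_signs_finite_family[of n a "2 ^ n"] assms by blast
  have "cmod (\<Sum>r<t. \<epsilon> r * a k r) \<le> 8 * sqrt (n * ln (2 * real k))"
    if k: "k \<ge> 1" and t: "t \<le> n" for k t
  proof (cases "k \<le> 2 ^ n")
    case True
    then show ?thesis using small k t by simp
  next
    case False
    then have "real (2 ^ n) \<le> real (2 * k)"
      by (intro of_nat_mono) simp
    then have "ln (2 ^ n) \<le> ln (2 * real k)"
      by (intro ln_mono) simp_all
    then have "n * ln 2 \<le> ln (2 * real k)"
      by (simp add: ln_realpow)
    moreover have "real n * (1 / 2) \<le> n * ln 2"
      using ln2_ge_two_thirds by (intro mult_left_mono) auto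
    \<comment> \<open>\<open>64\<close> is the square of the constant 8 in the claim, so that the
      trivial bound by \<open>n\<close> suffices.\<close>
    ultimately have "n \<le> 64 * ln (2 * real k)"
      using \<open>n > 0\<close> by linarith
    then have "real n * real n \<le> 64 * (n * ln (2 * real k))"
      using mult_left_mono[of "real n" "64 * ln (2 * real k)" "real n"] by simp
    then have "real n \<le> sqrt (64 * (n * ln (2 * real k)))"
      by (intro real_le_rsqrt) (simp add: power2_eq_square)
    moreover have "sqrt (64 :: real) = 8"
      by (rule real_sqrt_unique) auto
    ultimately have "n \<le> 8 * sqrt (n * ln (2 * real k))"
      by (simp add: real_sqrt_mult)
    moreover have "cmod (\<Sum>r<t. \<epsilon> r * a k r) \<le> (\<Sum>r<t. 1)"
    proof (rule order_trans[OF norm_sum sum_mono])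
      fix r
      show "cmod (\<epsilon> r * a k r) \<le> 1"
        using \<epsilon>[of r] a[of k r] by (auto simp: norm_mult)
    qed
    ultimately show ?thesis using t by simp
  qed
  then show ?thesis using \<epsilon> by blast
qed

section \<open>Dyadic interval centers driven by the signs\<close>

definition good_signs :: "nat \<Rightarrow> (nat \<Rightarrow> real) \<Rightarrow> (nat \<Rightarrow> real) \<Rightarrow> bool" where
  "good_signs n c \<epsilon> \<longleftrightarrow> (\<forall>r. \<epsilon> r \<in> {1, -1}) \<and>
     (\<forall>k\<ge>1. \<forall>t\<le>n. cmod (\<Sum>r<t. \<epsilon> r * cis (2 * pi * real k * c r)) \<le> 8 * sqrt (n * ln (2 * real k)))"

text \<open>Choosing by \<open>SOME\<close> makes the signs a function of the centers of a level, so
  that \<open>center\<close> can be defined by recursion.\<close>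

definition signs :: "nat \<Rightarrow> (nat \<Rightarrow> real) \<Rightarrow> nat \<Rightarrow> real" where
  "signs n c = (SOME \<epsilon>. good_signs n c \<epsilon>)"

lemma good_signs_signs:
  assumes "n > 0"
  shows "good_signs n c (signs n c)"
proof -
  have "\<exists>\<epsilon>. good_signs n c \<epsilon>"
    unfolding good_signs_def using assms by (rule exists_signs) simp
  then show ?thesis
    unfolding signs_def by (rule someI_ex)
qed

text \<open>\<open>center i n\<close> is the center of the interval of length \<open>1 / 2 ^ i\<close> that contains the
  \<open>n\<close>-th point of the sequence; it depends on \<open>n mod 2 ^ i\<close> only.\<close>

primrec center :: "nat \<Rightarrow> nat \<Rightarrow> real" where
  "center 0 n = 0"
| "center (Suc i) n = center i n
     + signs (2 ^ i) (center i) (n mod 2 ^ i) * (if even (n div 2 ^ i) then 1 else -1) / 2 ^ (i + 2)"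

abbreviation center_sign :: "nat \<Rightarrow> nat \<Rightarrow> real" where
  "center_sign i \<equiv> signs (2 ^ i) (center i)"

lemma center_sign_cases: "center_sign i r \<in> {1, -1}"
  using good_signs_signs[of "2 ^ i" "center i"] by (simp add: good_signs_def)

lemma center_sign_sum_le:
  assumes "k \<ge> 1" "t \<le> 2 ^ i"
  shows "cmod (\<Sum>r<t. center_sign i r * cis (2 * pi * real k * center i r))
    \<le> 8 * sqrt (2 ^ i * ln (2 * real k))"
  using good_signs_signs[of "2 ^ i" "center i"] assms by (simp add: good_signs_def)

lemma center_add_power2: "i \<le> j \<Longrightarrow> center i (2 ^ j + n) = center i n"
proof (induction i)
  case (Suc i)
  obtain d where j: "j = Suc i + d"
    using Suc.prems less_eqE by blast
  have "(2 ^ j + n) mod 2 ^ i = n mod 2 ^ i"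
    using mod_mult_self1[of n "2 * 2 ^ d" "2 ^ i"] by (simp add: j power_add mult_ac add_ac)
  moreover have "(2 ^ j + n) div 2 ^ i = 2 * 2 ^ d + n div 2 ^ i"
    using div_mult_self1[of "2 ^ i" n "2 * 2 ^ d"] by (simp add: j power_add mult_ac add_ac)
  ultimately show ?case using Suc by simp
qed simp

section \<open>Means over dyadic intervals and their partial sums\<close>

text \<open>A sinc value: for \<open>k \<ge> 1\<close>, the ratio between the mean of the character
  over an interval of length \<open>1 / 2 ^ i\<close> and its value at the center.\<close>

definition mean_factor :: "nat \<Rightarrow> nat \<Rightarrow> real" where
  "mean_factor k i = sin (pi * k / 2 ^ i) / (pi * k / 2 ^ i)"

text \<open>The mean of \<open>exp (2 * pi * \<i> * k * x)\<close> over the interval of length \<open>1 / 2 ^ i\<close>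
  centered at \<open>center i n\<close>, for \<open>k \<ge> 1\<close>. At \<open>k = 0\<close> the definition gives \<open>0\<close>.\<close>

definition interval_mean :: "nat \<Rightarrow> nat \<Rightarrow> nat \<Rightarrow> complex" where
  "interval_mean k i n = mean_factor k i * cis (2 * pi * k * center i n)"

text \<open>Up to a factor of modulus 1, the amount by which the mean over a half differs from the
  mean over the whole level-\<open>i\<close> interval.\<close>

definition mean_step :: "nat \<Rightarrow> nat \<Rightarrow> real" where
  "mean_step k i = mean_factor k (Suc i) * sin (pi * k / 2 ^ Suc i)"

lemma mean_factor_Suc: "mean_factor k i = mean_factor k (Suc i) * cos (pi * k / 2 ^ Suc i)"
proof -
  define \<theta> where "\<theta> = pi * k / 2 ^ Suc i"
  have "pi * k / 2 ^ i = 2 * \<theta>" by (simp add: \<theta>_def)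
  then show ?thesis
    unfolding mean_factor_def \<theta>_def[symmetric] by (simp add: sin_double)
qed

lemma interval_mean_add_power2: "interval_mean k i (2 ^ i + n) = interval_mean k i n"
  by (simp add: interval_mean_def center_add_power2)

text \<open>Expanding \<open>cis\<close> at the shifted center, the cosine part restores the parent
  mean by \<open>mean_factor_Suc\<close> and the sine part is the correction.\<close>

lemma interval_mean_Suc:
  "interval_mean k (Suc i) n = interval_mean k i n
    + (if even (n div 2 ^ i) then 1 else -1) * (\<i> * mean_step k i)
      * (center_sign i (n mod 2 ^ i) * cis (2 * pi * k * center i n))"
proof -
  define \<theta> where "\<theta> = pi * k / 2 ^ Suc i"
  define \<sigma> where "\<sigma> = center_sign i (n mod 2 ^ i) * (if even (n div 2 ^ i) then 1 else -1)"
  have \<sigma>: "\<sigma> \<in> {1, -1}"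
    using center_sign_cases[of i "n mod 2 ^ i"] by (auto simp: \<sigma>_def)
  have "2 * pi * k * center (Suc i) n = 2 * pi * k * center i n + \<sigma> * \<theta>"
    by (simp add: \<sigma>_def \<theta>_def algebra_simps)
  moreover have "cis (\<sigma> * \<theta>) = cos \<theta> + \<i> * \<sigma> * sin \<theta>"
    using \<sigma> by (auto simp: complex_eq_iff)
  ultimately have "cis (2 * pi * k * center (Suc i) n)
      = cis (2 * pi * k * center i n) * (cos \<theta> + \<i> * \<sigma> * sin \<theta>)"
    by (simp flip: cis_mult)
  then show ?thesis
    unfolding interval_mean_def mean_step_def mean_factor_Suc[of k i] \<theta>_def[symmetric]
    by (simp add: \<sigma>_def algebra_simps)
qed

lemma sum_lessThan_add: "(\<Sum>n<m + m'. f n) = (\<Sum>n<m. f n) + (\<Sum>n<m'. f (m + n))"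
  for f :: "nat \<Rightarrow> 'a :: comm_monoid_add"
  by (induction m') (simp_all add: add_ac)

lemma interval_mean_sum_low:
  assumes "m \<le> 2 ^ i"
  shows "(\<Sum>r<m. interval_mean k (Suc i) r) = (\<Sum>r<m. interval_mean k i r)
    + \<i> * mean_step k i * (\<Sum>r<m. center_sign i r * cis (2 * pi * k * center i r))"
  using assms unfolding sum_distrib_left sum.distrib[symmetric]
  by (intro sum.cong refl) (simp add: interval_mean_Suc)

text \<open>Index \<open>2 ^ i + r\<close> gets the half that index \<open>r\<close> does not, so
  the correction changes sign.\<close>

lemma interval_mean_sum_high:
  assumes "m \<le> 2 ^ i"
  shows "(\<Sum>r<m. interval_mean k (Suc i) (2 ^ i + r)) = (\<Sum>r<m. interval_mean k i r)
    - \<i> * mean_step k i * (\<Sum>r<m. center_sign i r * cis (2 * pi * k * center i r))"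
  using assms unfolding sum_distrib_left sum_subtractf[symmetric]
  by (intro sum.cong refl)
    (simp add: interval_mean_Suc interval_mean_add_power2 center_add_power2)

text \<open>The corrections of the lower and upper blocks cancel, and at level 0 the factor
  \<open>sin (pi * k)\<close> vanishes.\<close>

lemma interval_mean_sum_full: "(\<Sum>r<2 ^ i. interval_mean k i r) = 0"
proof (induction i)
  case 0
  show ?case by (simp add: interval_mean_def mean_factor_def)
next
  case (Suc i)
  have "(\<Sum>r<2 ^ Suc i. interval_mean k (Suc i) r)
      = (\<Sum>r<2 ^ i. interval_mean k (Suc i) r) + (\<Sum>r<2 ^ i. interval_mean k (Suc i) (2 ^ i + r))"
    by (simp add: mult_2 sum_lessThan_add)
  with Suc show ?case
    by (simp add: interval_mean_sum_low interval_mean_sum_high)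
qed

text \<open>A prefix longer than \<open>2 ^ i\<close> splits into a full block, whose
  level-\<open>i\<close> means cancel and leave one correction, and a shorter prefix with a second
  one; hence the factor 2 per level.\<close>

lemma interval_mean_sum_le:
  assumes "k \<ge> 1" "m \<le> 2 ^ i"
  shows "cmod (\<Sum>r<m. interval_mean k i r)
    \<le> (\<Sum>j<i. 2 * \<bar>mean_step k j\<bar> * (8 * sqrt (2 ^ j * ln (2 * real k))))"
  using assms(2)
proof (induction i arbitrary: m)
  case 0
  then show ?case
    by (cases m) (auto simp: interval_mean_def mean_factor_def)
next
  case (Suc i)
  define B where "B = 8 * sqrt (2 ^ i * ln (2 * real k))"
  define P where "P t = \<i> * mean_step k i
    * (\<Sum>r<t. center_sign i r * cis (2 * pi * k * center i r))" for t
  have P: "cmod (P t) \<le> \<bar>mean_step k i\<bar> * B" if "t \<le> 2 ^ i" for t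
    using center_sign_sum_le[OF assms(1) that]
    by (simp add: P_def B_def norm_mult mult_left_mono)
  have B0: "0 \<le> \<bar>mean_step k i\<bar> * B"
    using P[of 0] by (simp add: P_def)
  show ?case
  proof (cases "m \<le> 2 ^ i")
    case True
    then have "(\<Sum>r<m. interval_mean k (Suc i) r) = (\<Sum>r<m. interval_mean k i r) + P m"
      by (simp add: interval_mean_sum_low P_def)
    then show ?thesis
      using norm_triangle_ineq[of "\<Sum>r<m. interval_mean k i r" "P m"] P[OF True] Suc.IH[OF True] B0
      by (simp add: B_def)
  next
    case False
    then obtain m' where m': "m = 2 ^ i + m'"
      using less_imp_add_positive by (metis not_le)
    then have "m' \<le> 2 ^ i" using Suc.prems by simp
    then have "(\<Sum>r<m. interval_mean k (Suc i) r) = P (2 ^ i) + ((\<Sum>r<m'. interval_mean k i r) - P m')"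
      by (simp add: m' sum_lessThan_add interval_mean_sum_low interval_mean_sum_high
          interval_mean_sum_full P_def)
    then have "cmod (\<Sum>r<m. interval_mean k (Suc i) r)
        \<le> cmod (P (2 ^ i)) + (cmod (\<Sum>r<m'. interval_mean k i r) + cmod (P m'))"
      using norm_triangle_ineq norm_triangle_ineq4 by (smt (verit))
    then show ?thesis
      using P[of "2 ^ i"] P[OF \<open>m' \<le> 2 ^ i\<close>] Suc.IH[OF \<open>m' \<le> 2 ^ i\<close>]
      by (simp add: B_def)
  qed
qed

section \<open>Summing the corrections over all levels\<close>

lemma mean_step_le:
  assumes "k \<ge> 1"
  shows "\<bar>mean_step k i\<bar> \<le> 2 * min 1 (k / 2 ^ i)"
proof -
  define \<theta> where "\<theta> = pi * k / 2 ^ Suc i"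
  have "0 < \<theta>" using assms by (simp add: \<theta>_def)
  have sin: "\<bar>sin \<theta>\<bar> \<le> \<theta>"
    using abs_sin_x_le_abs_x[of \<theta>] \<open>0 < \<theta>\<close> by simp
  then have "\<bar>sin \<theta> / \<theta>\<bar> \<le> 1"
    using \<open>0 < \<theta>\<close> by simp
  moreover have "mean_step k i = sin \<theta> / \<theta> * sin \<theta>"
    by (simp add: mean_step_def mean_factor_def \<theta>_def)
  ultimately have "\<bar>mean_step k i\<bar> \<le> \<bar>sin \<theta>\<bar>"
    by (simp only: abs_mult) (rule mult_left_le_one_le; simp)
  moreover have "\<theta> \<le> 2 * (k / 2 ^ i)"
    using pi_less_4 mult_right_mono[of pi 4 "real k"] by (simp add: \<theta>_def divide_simps)
  moreover have "\<bar>sin \<theta>\<bar> \<le> 2"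
    using abs_sin_le_one[of \<theta>] by linarith
  ultimately show ?thesis
    using sin by (simp add: min_def)
qed

text \<open>The increments of \<open>12 q u / (u + q)\<close> along \<open>u = sqrt 2 ^ i\<close>, where \<open>q = sqrt x\<close>,
  dominate the summands.\<close>

lemma sum_min_geometric_le:
  assumes "x > 0"
  shows "(\<Sum>i<n. min (sqrt 2 ^ i) (x / sqrt 2 ^ i)) \<le> 12 * sqrt x"
proof -
  define q where "q = sqrt x"
  define s :: real where "s = sqrt 2"
  define f where "f i = 12 * q * s ^ i / (s ^ i + q)" for i
  have q: "0 < q" "x = q * q" using assms by (simp_all add: q_def)
  have "1.41 < s" unfolding s_def by (rule real_less_rsqrt) (simp add: power2_eq_square)
  have "min (s ^ i) (x / s ^ i) \<le> f (Suc i) - f i" for i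
  proof -
    define u where "u = s ^ i"
    have "0 < u" using \<open>1.41 < s\<close> by (simp add: u_def)
    have diff: "f (Suc i) - f i = 12 * (s - 1) * u * q\<^sup>2 / ((s * u + q) * (u + q))"
    proof -
      have "s * u + q \<noteq> 0" "u + q \<noteq> 0"
        using q \<open>0 < u\<close> \<open>1.41 < s\<close> by (simp_all add: add_pos_pos less_imp_neq[symmetric])
      then show ?thesis
        unfolding f_def power_Suc u_def[symmetric]
        by (simp add: field_simps power2_eq_square)
    qed
    have pos: "0 < (s * u + q) * (u + q)"
      using q \<open>0 < u\<close> \<open>1.41 < s\<close> by (intro mult_pos_pos add_pos_pos) auto
    \<comment> \<open>Equivalent to \<open>s \<ge> 1.4\<close>; the constant 12 is large enough for
      this.\<close>
    have s: "2 * (s + 1) \<le> 12 * (s - 1)" using \<open>1.41 < s\<close> by simp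
    have "min u (x / u) \<le> 12 * (s - 1) * u * q\<^sup>2 / ((s * u + q) * (u + q))"
    \<comment> \<open>In either case the larger of \<open>u\<close> and \<open>q\<close> replaces
      the smaller in the denominator.\<close>
    proof (cases "u \<le> q")
      case True
      have "(s * u + q) * (u + q) \<le> (s * q + q) * (q + q)"
        using True q \<open>0 < u\<close> \<open>1.41 < s\<close> by (intro mult_mono add_mono) auto
      also have "\<dots> = 2 * (s + 1) * q\<^sup>2" by (simp add: algebra_simps power2_eq_square)
      also have "\<dots> \<le> 12 * (s - 1) * q\<^sup>2" using s by (rule mult_right_mono) simp
      finally have "u * ((s * u + q) * (u + q)) \<le> u * (12 * (s - 1) * q\<^sup>2)"
        using \<open>0 < u\<close> by (intro mult_left_mono) auto
      then have "u \<le> 12 * (s - 1) * u * q\<^sup>2 / ((s * u + q) * (u + q))"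
        using pos by (simp add: pos_le_divide_eq mult_ac)
      then show ?thesis by simp
    next
      case False
      have "(s * u + q) * (u + q) \<le> (s * u + u) * (u + u)"
        using False q \<open>0 < u\<close> \<open>1.41 < s\<close> by (intro mult_mono add_mono) auto
      also have "\<dots> = 2 * (s + 1) * u\<^sup>2" by (simp add: algebra_simps power2_eq_square)
      also have "\<dots> \<le> 12 * (s - 1) * u\<^sup>2" using s by (rule mult_right_mono) simp
      finally have "x / u * ((s * u + q) * (u + q)) \<le> x / u * (12 * (s - 1) * u\<^sup>2)"
        using \<open>0 < u\<close> assms by (intro mult_left_mono) auto
      also have "\<dots> = 12 * (s - 1) * u * q\<^sup>2"
        using \<open>0 < u\<close> by (simp add: q(2) power2_eq_square)
      finally have "x / u \<le> 12 * (s - 1) * u * q\<^sup>2 / ((s * u + q) * (u + q))"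
        using pos by (simp add: pos_le_divide_eq)
      then show ?thesis by simp
    qed
    then show ?thesis by (simp add: diff u_def)
  qed
  then have "(\<Sum>i<n. min (s ^ i) (x / s ^ i)) \<le> (\<Sum>i<n. f (Suc i) - f i)"
    by (intro sum_mono)
  also have "\<dots> = f n - f 0" by (rule sum_lessThan_telescope)
  also have "\<dots> \<le> f n" using q by (simp add: f_def)
  also have "\<dots> \<le> 12 * q"
  proof -
    have "0 < s ^ n" using \<open>1.41 < s\<close> by simp
    then show ?thesis using q by (simp add: f_def field_simps)
  qed
  finally show ?thesis by (simp add: s_def q_def)
qed

text \<open>The constant is \<open>2 * 2 * 8 * 12\<close>: two corrections per level, then the
  factors from \<open>mean_step_le\<close>, the sign bound and the geometric sum.\<close>

lemma interval_mean_sum_uniform: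
  assumes "k \<ge> 1" "N \<le> 2 ^ i"
  shows "cmod (\<Sum>r<N. interval_mean k i r) \<le> 384 * sqrt (real k * ln (2 * real k))"
proof -
  have "2 * \<bar>mean_step k j\<bar> * (8 * sqrt (2 ^ j * ln (2 * real k)))
      \<le> 32 * sqrt (ln (2 * real k)) * min (sqrt 2 ^ j) (k / sqrt 2 ^ j)" for j
  proof -
    have "min 1 (k / 2 ^ j) * sqrt 2 ^ j = min (sqrt 2 ^ j) (k / sqrt 2 ^ j)"
    proof -
      have "(2 :: real) ^ j = sqrt 2 ^ j * sqrt 2 ^ j"
        by (simp flip: power_mult_distrib)
      then show ?thesis
        by (simp add: min_mult_distrib_right)
    qed
    moreover have "2 * \<bar>mean_step k j\<bar> * (8 * sqrt (2 ^ j * ln (2 * real k)))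
        \<le> 2 * (2 * min 1 (k / 2 ^ j)) * (8 * sqrt (2 ^ j * ln (2 * real k)))"
      using mean_step_le[OF assms(1), of j] assms(1) by (intro mult_mono) auto
    moreover have "2 * (2 * min 1 (k / 2 ^ j)) * (8 * sqrt (2 ^ j * ln (2 * real k)))
        = 32 * sqrt (ln (2 * real k)) * (min 1 (k / 2 ^ j) * sqrt 2 ^ j)"
      by (simp add: real_sqrt_mult real_sqrt_power)
    ultimately show ?thesis by simp
  qed
  then have "(\<Sum>j<i. 2 * \<bar>mean_step k j\<bar> * (8 * sqrt (2 ^ j * ln (2 * real k))))
      \<le> 32 * sqrt (ln (2 * real k)) * (\<Sum>j<i. min (sqrt 2 ^ j) (k / sqrt 2 ^ j))"
    unfolding sum_distrib_left by (rule sum_mono)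
  also have "\<dots> \<le> 32 * sqrt (ln (2 * real k)) * (12 * sqrt k)"
    using sum_min_geometric_le[of k i] assms(1) by (intro mult_left_mono) auto
  also have "\<dots> = 384 * sqrt (real k * ln (2 * real k))"
    by (simp add: real_sqrt_mult)
  finally show ?thesis
    using interval_mean_sum_le[OF assms] by linarith
qed

section \<open>The limit points and their exponential sums\<close>

definition point :: "nat \<Rightarrow> real" where
  "point n = lim (\<lambda>i. center i n)"

lemma center_tendsto_point: "(\<lambda>i. center i n) \<longlonglongrightarrow> point n"
proof -
  have le: "norm (center (Suc i) n - center i n) \<le> 1 / 4 * (1 / 2) ^ i" for i
    using center_sign_cases[of i "n mod 2 ^ i"] by (auto simp: power_one_over)
  have "summable (\<lambda>i. 1 / 4 * (1 / 2 :: real) ^ i)"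
    by (intro summable_mult summable_geometric) simp
  then have "summable (\<lambda>i. center (Suc i) n - center i n)"
    by (rule summable_comparison_test') (rule le)
  then have "convergent (\<lambda>m. \<Sum>i<m. center (Suc i) n - center i n)"
    by (simp only: summable_iff_convergent)
  then have "convergent (\<lambda>i. center i n)"
    unfolding sum_lessThan_telescope[of "\<lambda>i. center i n"] by simp
  then show ?thesis
    by (simp add: point_def convergent_LIMSEQ_iff)
qed

lemma mean_factor_tendsto:
  assumes "k \<ge> 1"
  shows "mean_factor k \<longlonglongrightarrow> 1"
proof -
  have "(\<lambda>i. pi * k * (1 / 2) ^ i) \<longlonglongrightarrow> pi * k * 0"
    by (intro tendsto_mult_left LIMSEQ_power_zero) auto
  then have "(\<lambda>i. pi * k / 2 ^ i) \<longlonglongrightarrow> 0"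
    by (simp add: power_one_over)
  then have "filterlim (\<lambda>i. pi * k / 2 ^ i) (at 0) sequentially"
    using assms by (auto simp: filterlim_at)
  moreover have "((\<lambda>y :: real. sin y / y) \<longlongrightarrow> 1) (at 0)"
    using DERIV_sin[of 0] by (simp add: has_field_derivative_iff)
  ultimately show ?thesis
    unfolding mean_factor_def using filterlim_compose by blast
qed

text \<open>For fixed \<open>N\<close> the interval means tend to the character values at the
  points, and the uniform bound applies once \<open>N \<le> 2 ^ i\<close>.\<close>

lemma point_sum_le:
  assumes "k \<ge> 1"
  shows "cmod (\<Sum>n<N. cis (2 * pi * k * point n)) \<le> 384 * sqrt (real k * ln (2 * real k))"
proof (rule Lim_bounded)
  show "(\<lambda>i. cmod (\<Sum>n<N. interval_mean k i n)) \<longlonglongrightarrow> cmod (\<Sum>n<N. cis (2 * pi * k * point n))"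
  proof (intro tendsto_norm tendsto_sum)
    fix n
    have "(\<lambda>i. mean_factor k i * cis (2 * pi * k * center i n))
        \<longlonglongrightarrow> of_real 1 * cis (2 * pi * k * point n)"
      by (intro tendsto_mult tendsto_of_real tendsto_cis mean_factor_tendsto[OF assms]
          tendsto_const center_tendsto_point)
    then show "(\<lambda>i. interval_mean k i n) \<longlonglongrightarrow> cis (2 * pi * k * point n)"
      by (simp add: interval_mean_def)
  qed
  show "\<forall>i\<ge>N. cmod (\<Sum>n<N. interval_mean k i n) \<le> 384 * sqrt (real k * ln (2 * real k))"
  proof (intro allI impI interval_mean_sum_uniform assms)
    fix i assume "N \<le> i"
    also have "i \<le> 2 ^ i" by (rule less_imp_le[OF less_exp])
    finally show "N \<le> 2 ^ i" .
  qed
qed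

theorem theorem3p1:
  "\<exists>x :: nat \<Rightarrow> real_mod_int. \<exists>C :: real. C > 0 \<and>
     (\<forall>k :: int. k \<ge> 1 \<longrightarrow>
        exp_sum_sup x k \<le> ereal (C * sqrt (real_of_int k * ln (2 * real_of_int k))))"
proof (intro exI conjI allI impI)
  show "(384 :: real) > 0" by simp
  fix k :: int
  assume "k \<ge> 1"
  then obtain k' :: nat where k': "k = int k'" "k' \<ge> 1"
    by (metis nonneg_int_cases of_nat_1 of_nat_le_iff order_trans zero_le_one)
  have "circle_char k (abs_real_mod_int (point n)) = cis (2 * pi * k' * point n)" for n
    by (simp add: circle_char.abs_eq k' cis_conv_exp mult_ac)
  then show "exp_sum_sup (\<lambda>n. abs_real_mod_int (point n)) k
      \<le> ereal (384 * sqrt (real_of_int k * ln (2 * real_of_int k)))"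
    unfolding exp_sum_sup_def using point_sum_le[OF k'(2)]
    by (intro SUP_least) (simp add: k'(1))
qed

end
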